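(* Let $\mu>0$ and let $F$ be a differentiable strongly exponentially general convex function (with constant $\mu$) on the general convex set $K_g$. If $u\in H$ with $g(u)\in K_g$ is the minimum of the function $F$, that is, $F(g(u))\le F(g(v))$ for all $v\in H$ with $g(v)\in K_g$, then $$e^{F(g(v))}-e^{F(g(u))}\ge\mu\,\|g(v)-g(u)\|^2\qquad\text{for all } v\in H\text{ with } g(v)\in K_g .$$
   Context: $H$ is a real Hilbert space with norm $\|\cdot\|$, and $g:H\to H$ is an arbitrary function. $K_g\subseteq H$ is a general convex set with respect to $g$: $g(u)+t(g(v)-g(u))\in K_g$ for all $u,v\in H$ with $g(u),g(v)\in K_g$ and all $t\in[0,1]$. As a standing assumption $g$ is onto $K_g$ (every point of $K_g$ is $g(v)$ for some $v\in H$). A positive real-valued function $F$ on $K_g$ is strongly exponentially general convex with constant $\mu>0$ if $$e^{F(g(u)+t(g(v)-g(u)))}\le(1-t)e^{F(g(u))}+te^{F(g(v))}-\mu\,t(1-t)\,\|g(v)-g(u)\|^2$$ for all $u,v\in H$ with $g(u),g(v)\in K_g$ and all $t\in[0,1]$. "Differentiable" means Fréchet differentiable at the points of $K_g$ ($F$ being understood as defined near $K_g$). *)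

theory Defs
  imports "HOL-Analysis.Analysis"
begin

definition general_convex_set :: "('a::real_vector \<Rightarrow> 'a) \<Rightarrow> 'a set \<Rightarrow> bool" where
  "general_convex_set g K \<longleftrightarrow>
    (\<forall>u v t. g u \<in> K \<longrightarrow> g v \<in> K \<longrightarrow> 0 \<le> t \<longrightarrow> t \<le> 1 \<longrightarrow>
      g u + t *\<^sub>R (g v - g u) \<in> K)"

text \<open>The function \<open>F\<close> is total; only its values on \<open>K\<close> are constrained.\<close>

definition strongly_exp_general_convex ::
  "('a::real_normed_vector \<Rightarrow> 'a) \<Rightarrow> 'a set \<Rightarrow> real \<Rightarrow> ('a \<Rightarrow> real) \<Rightarrow> bool" where
  "strongly_exp_general_convex g K \<mu> F \<longleftrightarrow>
    (\<forall>x\<in>K. 0 < F x) \<and>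
    (\<forall>u v t. g u \<in> K \<longrightarrow> g v \<in> K \<longrightarrow> 0 \<le> t \<longrightarrow> t \<le> 1 \<longrightarrow>
      exp (F (g u + t *\<^sub>R (g v - g u))) \<le>
        (1 - t) * exp (F (g u)) + t * exp (F (g v))
          - \<mu> * t * (1 - t) * (norm (g v - g u))\<^sup>2)"

text \<open>
  Frechet differentiability of \<open>F\<close> at each point of \<open>K\<close>, in the unrestricted sense of
  \<open>at x\<close> rather than \<open>at x within K\<close>: \<open>F\<close> is understood as defined near \<open>K\<close>.
  Hence this is not \<open>F differentiable_on K\<close>.
\<close>

definition differentiable_at_points :: "'a::real_normed_vector set \<Rightarrow> ('a \<Rightarrow> real) \<Rightarrow> bool" where
  "differentiable_at_points K F \<longleftrightarrow> (\<forall>x\<in>K. F differentiable (at x))"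

end

theory Submission
  imports Defs
begin

text \<open>
  Put \<open>f = exp \<circ> F\<close>; since \<open>exp\<close> is increasing, \<open>g u\<close> also minimises \<open>f\<close> over \<open>K\<close>. On the segment
  from \<open>g u\<close> to \<open>g v\<close>, strong convexity bounds \<open>f\<close> at parameter \<open>t\<close> by the chord minus
  \<open>\<mu> t (1 - t) \<parallel>g v - g u\<parallel>\<^sup>2\<close>, while minimality bounds it below by \<open>f (g u)\<close>. Comparing the two bounds
  and cancelling \<open>t > 0\<close> leaves \<open>f (g v) - f (g u) \<ge> \<mu> (1 - t) \<parallel>g v - g u\<parallel>\<^sup>2\<close>; the claim follows as
  \<open>t\<close> tends to \<open>0\<close>.
\<close>

text \<open>
  The one-dimensional core: along the segment, the defect \<open>c t (1 - t)\<close> has slope \<open>c\<close> at the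
  minimiser \<open>t = 0\<close>, so the chord must climb at least that steeply for the values to stay
  above \<open>\<phi> 0\<close>.
\<close>

lemma strong_convexity_growth_from_minimum:
  fixes \<phi> :: "real \<Rightarrow> real"
  assumes minimal: "\<And>t. 0 < t \<Longrightarrow> t < 1 \<Longrightarrow> \<phi> 0 \<le> \<phi> t"
    and convex: "\<And>t. 0 < t \<Longrightarrow> t < 1 \<Longrightarrow>
      \<phi> t \<le> (1 - t) * \<phi> 0 + t * \<phi> 1 - c * t * (1 - t)"
  shows "c \<le> \<phi> 1 - \<phi> 0"
proof (rule field_le_mult_one_interval)
  \<comment> \<open>Here \<open>s = 1 - t\<close>, so the limit \<open>t \<rightarrow> 0\<close> becomes \<open>s \<rightarrow> 1\<close>.\<close>
  fix s :: real
  assume s: "0 < s" "s < 1"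
  have "\<phi> 0 \<le> s * \<phi> 0 + (1 - s) * \<phi> 1 - c * (1 - s) * s"
    using minimal[of "1 - s"] convex[of "1 - s"] s by simp
  then have "(1 - s) * (s * c) \<le> (1 - s) * (\<phi> 1 - \<phi> 0)"
    by (simp add: algebra_simps)
  then show "s * c \<le> \<phi> 1 - \<phi> 0"
    using s by simp
qed

theorem theorem34:
  fixes g :: "'a::{real_inner, complete_space} \<Rightarrow> 'a"
    and K :: "'a set"
    and F :: "'a \<Rightarrow> real"
    and \<mu> :: real
    and u :: 'a
  assumes "general_convex_set g K"
    and "K \<subseteq> range g"
    and "\<mu> > 0"
    and "differentiable_at_points K F"
    and "strongly_exp_general_convex g K \<mu> F"
    and "g u \<in> K"
    and "\<forall>v. g v \<in> K \<longrightarrow> F (g u) \<le> F (g v)"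
  shows "\<forall>v. g v \<in> K \<longrightarrow> exp (F (g v)) - exp (F (g u)) \<ge> \<mu> * (norm (g v - g u))\<^sup>2"
proof (intro allI impI)
  fix v
  assume v: "g v \<in> K"
  let ?\<phi> = "\<lambda>t. exp (F (g u + t *\<^sub>R (g v - g u)))"
  have "\<mu> * (norm (g v - g u))\<^sup>2 \<le> ?\<phi> 1 - ?\<phi> 0"
  proof (rule strong_convexity_growth_from_minimum)
    fix t :: real
    assume t: "0 < t" "t < 1"
    have "g u + t *\<^sub>R (g v - g u) \<in> K"
      using assms(1,6) v t unfolding general_convex_set_def by simp
    \<comment> \<open>Minimality speaks only of points \<open>g w\<close>, so the point of the segment has to be written
      as such a value; this is where surjectivity onto \<open>K\<close> enters.\<close>
    moreover from this obtain w where "g u + t *\<^sub>R (g v - g u) = g w"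
      using assms(2) by blast
    ultimately show "?\<phi> 0 \<le> ?\<phi> t"
      using assms(7) by simp
    have "?\<phi> t \<le> (1 - t) * exp (F (g u)) + t * exp (F (g v))
        - \<mu> * t * (1 - t) * (norm (g v - g u))\<^sup>2"
      using assms(5,6) v t unfolding strongly_exp_general_convex_def by simp
    then show "?\<phi> t \<le> (1 - t) * ?\<phi> 0 + t * ?\<phi> 1 - \<mu> * (norm (g v - g u))\<^sup>2 * t * (1 - t)"
      by (simp add: mult_ac)
  qed
  then show "\<mu> * (norm (g v - g u))\<^sup>2 \<le> exp (F (g v)) - exp (F (g u))"
    by simp
qed

end
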